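(* Let $n\ge 1$ and $k\in\{1,\dots,n\}$. Then the map \[ \varphi_2:\{P\in\mathbb{R}^{n\times n}:P^{\mathsf T}=P=P^2,\ \operatorname{tr}(P)=k\}\to\{Q\in \mathrm{O}(n): Q^{\mathsf T}=Q,\ \operatorname{tr}(Q)=2k-n\},\qquad \varphi_2(P)=2P-I, \] is a diffeomorphism, with inverse $\varphi_2^{-1}(Q)=\tfrac12(I+Q)$.
   Context: Both sets carry their smooth structures as embedded submanifolds of $\mathbb{R}^{n\times n}$. $\mathrm{O}(n)$ is the group of real $n\times n$ orthogonal matrices and $I$ the $n\times n$ identity matrix. *)

theory Defs
  imports "HOL-Analysis.Analysis"
begin

text \<open>
  Continuous differentiability of order \<open>m\<close> for a map defined on a relatively open subset \<open>W\<close> of a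
  linear subspace \<open>L\<close>. The derivative within \<open>W\<close> is determined by \<open>f\<close> only in directions tangent
  to \<open>L\<close>, and only these are differentiated further; for \<open>L = UNIV\<close> this is the usual notion on an
  open set.
\<close>

primrec Ck_on ::
  "'a::euclidean_space set \<Rightarrow> nat \<Rightarrow> 'a set \<Rightarrow> ('a \<Rightarrow> 'b::euclidean_space) \<Rightarrow> bool"
where
  "Ck_on L 0 W f \<longleftrightarrow> continuous_on W f"
| "Ck_on L (Suc m) W f \<longleftrightarrow>
     (\<exists>f'. (\<forall>x\<in>W. (f has_derivative f' x) (at x within W)) \<and>
           (\<forall>v\<in>L. Ck_on L m W (\<lambda>x. f' x v)))"

definition smooth_on_in ::
  "'a::euclidean_space set \<Rightarrow> 'a set \<Rightarrow> ('a \<Rightarrow> 'b::euclidean_space) \<Rightarrow> bool"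
where
  "smooth_on_in L W f \<longleftrightarrow> (\<forall>m. Ck_on L m W f)"

text \<open>
  Slice charts: \<open>\<Phi>\<close> is a diffeomorphism between open subsets of the ambient space that flattens
  \<open>M\<close> to a linear subspace \<open>L\<close>. The subspace \<open>L\<close>, rather than a power of the real line, is the
  model space, so that the dimension of \<open>M\<close> need not be encoded in a type; the restriction of
  \<open>\<Phi>\<close> to \<open>U \<inter> M\<close>, with values in \<open>L\<close>, is a chart of the induced smooth structure.
\<close>

definition slice_chart ::
  "'a::euclidean_space set \<Rightarrow> 'a set \<Rightarrow> ('a \<Rightarrow> 'a) \<Rightarrow> 'a set \<Rightarrow> bool"
where
  "slice_chart M U \<Phi> L \<longleftrightarrow>
     open U \<and> open (\<Phi> ` U) \<and> inj_on \<Phi> U \<and>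
     smooth_on_in UNIV U \<Phi> \<and> smooth_on_in UNIV (\<Phi> ` U) (inv_into U \<Phi>) \<and>
     subspace L \<and> \<Phi> ` (U \<inter> M) = \<Phi> ` U \<inter> L"

definition embedded_submanifold :: "'a::euclidean_space set \<Rightarrow> bool"
where
  "embedded_submanifold M \<longleftrightarrow>
     (\<exists>d. \<forall>p\<in>M. \<exists>U \<Phi> L. p \<in> U \<and> slice_chart M U \<Phi> L \<and> dim L = d)"

text \<open>Smoothness with respect to the induced structures: smoothness of the coordinate expressions.\<close>

definition smooth_map ::
  "'a::euclidean_space set \<Rightarrow> 'b::euclidean_space set \<Rightarrow> ('a \<Rightarrow> 'b) \<Rightarrow> bool"
where
  "smooth_map M N f \<longleftrightarrow>
     f ` M \<subseteq> N \<and>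
     (\<forall>p\<in>M. \<exists>U \<Phi> L U' \<Phi>' L'.
        p \<in> U \<and> slice_chart M U \<Phi> L \<and> slice_chart N U' \<Phi>' L' \<and>
        f ` (U \<inter> M) \<subseteq> U' \<and>
        smooth_on_in L (\<Phi> ` (U \<inter> M)) (\<Phi>' \<circ> f \<circ> inv_into U \<Phi>))"

definition diffeomorphism ::
  "'a::euclidean_space set \<Rightarrow> 'b::euclidean_space set \<Rightarrow> ('a \<Rightarrow> 'b) \<Rightarrow> bool"
where
  "diffeomorphism M N f \<longleftrightarrow>
     embedded_submanifold M \<and> embedded_submanifold N \<and>
     bij_betw f M N \<and> smooth_map M N f \<and> smooth_map N M (inv_into M f)"

definition projections_of_trace :: "nat \<Rightarrow> (real^'n^'n) set"
where
  "projections_of_trace k = {P. transpose P = P \<and> P = P ** P \<and> trace P = real k}"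

definition symmetric_orthogonal_of_trace :: "real \<Rightarrow> (real^'n^'n) set"
where
  "symmetric_orthogonal_of_trace t = {Q. orthogonal_matrix Q \<and> transpose Q = Q \<and> trace Q = t}"

definition phi2 :: "real^'n^'n \<Rightarrow> real^'n^'n"
where
  "phi2 P = 2 *\<^sub>R P - mat 1"

end

theory Submission imports Defs begin

text \<open>
  The map \<open>P \<mapsto> 2P - I\<close> is the restriction of an affine automorphism of the matrix space, which carries
  slice charts to slice charts; in the transported charts it becomes the identity. So everything
  rests on the projections of trace \<open>k\<close> forming an embedded submanifold. Near a given projection \<open>P\<close>,
  every other one is the orthogonal projection onto the graph of a linear map \<open>B\<close> from \<open>range P\<close> to its
  orthogonal complement, and its four blocks are rational functions of \<open>B\<close>. Subtracting these rational
  functions gives a flattening of the ambient space whose inverse is explicit, so that the inverse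
  function theorem is not needed. The model space consists of all \<open>(I - P) X P\<close> and has dimension
  \<open>(n - k) k\<close>, the trace of the projection \<open>X \<mapsto> (I - P) X P\<close>.
\<close>

section \<open>Differentiability of order \<open>m\<close>\<close>

lemma Ck_on_cong:
  assumes "\<And>x. x \<in> W \<Longrightarrow> f x = g x"
  shows "Ck_on L m W f \<longleftrightarrow> Ck_on L m W g"
proof (cases m)
  case 0
  then show ?thesis using assms by (simp cong: continuous_on_cong)
next
  case (Suc n)
  have "(f has_derivative f') (at x within W) \<longleftrightarrow> (g has_derivative f') (at x within W)"
    if "x \<in> W" for x f'
    using assms that by (metis has_derivative_transform)
  then show ?thesis by (simp add: Suc cong: conj_cong)
qed

lemma Ck_on_SucI:
  assumes "\<And>x. x \<in> W \<Longrightarrow> (f has_derivative f' x) (at x within W)"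
    and "\<And>v. v \<in> L \<Longrightarrow> Ck_on L m W (\<lambda>x. f' x v)"
  shows "Ck_on L (Suc m) W f"
  using assms by auto

lemma Ck_on_SucE:
  assumes "Ck_on L (Suc m) W f"
  obtains f' where "\<And>x. x \<in> W \<Longrightarrow> (f has_derivative f' x) (at x within W)"
    and "\<And>v. v \<in> L \<Longrightarrow> Ck_on L m W (\<lambda>x. f' x v)"
  using assms by auto

lemma Ck_on_const: "Ck_on L m W (\<lambda>x. c)"
proof (induction m arbitrary: c)
  case (Suc m)
  show ?case by (rule Ck_on_SucI[where f' = "\<lambda>x v. 0"]) (auto intro: Suc)
qed simp

lemma Ck_on_ident: "Ck_on L m W (\<lambda>x. x)"
proof (cases m)
  case (Suc n)
  show ?thesis
    unfolding Suc by (rule Ck_on_SucI[where f' = "\<lambda>x v. v"]) (auto intro: Ck_on_const)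
qed (simp add: continuous_on_id)

lemma Ck_on_SucD: "Ck_on L (Suc m) W f \<Longrightarrow> Ck_on L m W f"
proof (induction m arbitrary: f)
  case 0
  then show ?case by (auto intro: has_derivative_continuous_on)
next
  case (Suc m)
  obtain f' where
    f': "\<And>x. x \<in> W \<Longrightarrow> (f has_derivative f' x) (at x within W)"
    "\<And>v. v \<in> L \<Longrightarrow> Ck_on L (Suc m) W (\<lambda>x. f' x v)"
    by (rule Ck_on_SucE[OF Suc.prems]) blast
  show ?case by (rule Ck_on_SucI[OF f'(1) Suc.IH[OF f'(2)]])
qed

lemma Ck_on_bounded_linear:
  assumes "bounded_linear h" "Ck_on L m W f"
  shows "Ck_on L m W (\<lambda>x. h (f x))"
  using assms(2)
proof (induction m arbitrary: f)
  case 0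
  then show ?case using assms(1) by (simp add: bounded_linear.continuous_on)
next
  case (Suc m)
  obtain f' where
    f': "\<And>x. x \<in> W \<Longrightarrow> (f has_derivative f' x) (at x within W)"
    "\<And>v. v \<in> L \<Longrightarrow> Ck_on L m W (\<lambda>x. f' x v)" by (rule Ck_on_SucE[OF Suc.prems]) blast
  show ?case
    by (rule Ck_on_SucI[where f' = "\<lambda>x v. h (f' x v)"])
      (intro bounded_linear.has_derivative[OF assms(1)] f' Suc.IH; assumption)+
qed

lemma Ck_on_add:
  assumes "Ck_on L m W f" "Ck_on L m W g"
  shows "Ck_on L m W (\<lambda>x. f x + g x)"
  using assms
proof (induction m arbitrary: f g)
  case 0
  then show ?case by (simp add: continuous_on_add)
next
  case (Suc m)
  obtain f' g' where
    f'g': "\<And>x. x \<in> W \<Longrightarrow> (f has_derivative f' x) (at x within W)"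
    "\<And>v. v \<in> L \<Longrightarrow> Ck_on L m W (\<lambda>x. f' x v)"
    "\<And>x. x \<in> W \<Longrightarrow> (g has_derivative g' x) (at x within W)"
    "\<And>v. v \<in> L \<Longrightarrow> Ck_on L m W (\<lambda>x. g' x v)"
    by (rule Ck_on_SucE[OF Suc.prems(1)], rule Ck_on_SucE[OF Suc.prems(2)]) blast
  then show ?case
    by (intro Ck_on_SucI[where f' = "\<lambda>x v. f' x v + g' x v"] has_derivative_add Suc.IH)
qed

lemma Ck_on_uminus: "Ck_on L m W f \<Longrightarrow> Ck_on L m W (\<lambda>x. - f x)"
  by (rule Ck_on_bounded_linear[OF bounded_linear_minus[OF bounded_linear_ident]])

lemma Ck_on_diff:
  assumes "Ck_on L m W f" "Ck_on L m W g"
  shows "Ck_on L m W (\<lambda>x. f x - g x)"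
  using Ck_on_add[OF assms(1) Ck_on_uminus[OF assms(2)]] by simp

lemma Ck_on_bounded_bilinear:
  assumes "bounded_bilinear h" "Ck_on L m W f" "Ck_on L m W g"
  shows "Ck_on L m W (\<lambda>x. h (f x) (g x))"
  using assms(2,3)
proof (induction m arbitrary: f g)
  case 0
  then show ?case using assms(1) by (simp add: bounded_bilinear.continuous_on)
next
  case (Suc m)
  \<comment> \<open>The product rule brings back \<open>f\<close> and \<open>g\<close>
    undifferentiated, so both are also recorded at order \<open>m\<close>.\<close>
  note f_g = Suc.prems[THEN Ck_on_SucD]
  obtain f' g' where
    f'g': "\<And>x. x \<in> W \<Longrightarrow> (f has_derivative f' x) (at x within W)"
    "\<And>v. v \<in> L \<Longrightarrow> Ck_on L m W (\<lambda>x. f' x v)"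
    "\<And>x. x \<in> W \<Longrightarrow> (g has_derivative g' x) (at x within W)"
    "\<And>v. v \<in> L \<Longrightarrow> Ck_on L m W (\<lambda>x. g' x v)"
    by (rule Ck_on_SucE[OF Suc.prems(1)], rule Ck_on_SucE[OF Suc.prems(2)]) blast
  then show ?case
    by (intro Ck_on_SucI[where f' = "\<lambda>x v. h (f x) (g' x v) + h (f' x v) (g x)"]
        bounded_bilinear.FDERIV[OF assms(1)] Ck_on_add Suc.IH f_g)
qed

lemma Ck_on_sum:
  "(\<And>i. i \<in> I \<Longrightarrow> Ck_on L m W (f i)) \<Longrightarrow> Ck_on L m W (\<lambda>x. \<Sum>i\<in>I. f i x)"
  by (induction I rule: infinite_finite_induct) (auto intro: Ck_on_const Ck_on_add)

lemmas Ck_on_mult = Ck_on_bounded_bilinear[OF bounded_bilinear_mult]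

lemma Ck_on_prod:
  fixes f :: "'i \<Rightarrow> 'a::euclidean_space \<Rightarrow> real"
  shows "(\<And>i. i \<in> I \<Longrightarrow> Ck_on L m W (f i)) \<Longrightarrow> Ck_on L m W (\<lambda>x. \<Prod>i\<in>I. f i x)"
  by (induction I rule: infinite_finite_induct) (auto intro: Ck_on_const Ck_on_mult)

text \<open>The derivative of the reciprocal is a product of \<open>f'\<close> and the reciprocal
  itself, so its regularity climbs one order per induction step.\<close>

lemma Ck_on_inverse:
  fixes f :: "'a::euclidean_space \<Rightarrow> real"
  assumes "Ck_on L m W f" and nz: "\<And>x. x \<in> W \<Longrightarrow> f x \<noteq> 0"
  shows "Ck_on L m W (\<lambda>x. inverse (f x))"
  using assms(1)
proof (induction m)
  case 0
  then show ?case using nz by (simp add: continuous_on_inverse)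
next
  case (Suc m)
  have IH: "Ck_on L m W (\<lambda>x. inverse (f x))"
    using Suc Ck_on_SucD by blast
  obtain f' where
    f': "\<And>x. x \<in> W \<Longrightarrow> (f has_derivative f' x) (at x within W)"
    "\<And>v. v \<in> L \<Longrightarrow> Ck_on L m W (\<lambda>x. f' x v)" by (rule Ck_on_SucE[OF Suc.prems]) blast
  show ?case
    unfolding Ck_on.simps(2)
  proof (intro exI conjI ballI)
    show "((\<lambda>x. inverse (f x)) has_derivative (\<lambda>h. - (inverse (f x) * f' x h * inverse (f x)))) (at x within W)"
      if "x \<in> W" for x
      using Deriv.has_derivative_inverse[OF nz[OF that] f'(1)[OF that]] .
    show "Ck_on L m W (\<lambda>x. - (inverse (f x) * f' x v * inverse (f x)))" if "v \<in> L" for v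
      by (intro Ck_on_uminus Ck_on_mult IH f'(2)[OF that])
  qed
qed

text \<open>A vector is the finite sum of its components pushed through the linear injections
  \<open>axis i\<close>, which reduces the claim to sums and bounded linear maps.\<close>

lemma Ck_on_vec_lambda:
  fixes f :: "'a::euclidean_space \<Rightarrow> 'i::finite \<Rightarrow> 'b::euclidean_space"
  assumes "\<And>i. Ck_on L m W (\<lambda>x. f x i)"
  shows "Ck_on L m W (\<lambda>x. \<chi> i. f x i)"
proof -
  have "bounded_linear (axis i :: 'b \<Rightarrow> 'b^'i)" for i
    unfolding linear_conv_bounded_linear[symmetric]
    by (rule linearI) (auto simp: axis_def vec_eq_iff)
  then have "Ck_on L m W (\<lambda>x. \<Sum>i\<in>UNIV. axis i (f x i))"
    by (intro Ck_on_sum) (rule Ck_on_bounded_linear[OF _ assms])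
  moreover have "(\<Sum>i\<in>UNIV. axis i (f x i)) = (\<chi> i. f x i)" for x
    by (simp add: vec_eq_iff axis_def if_distrib cong: if_cong)
  ultimately show ?thesis by simp
qed

section \<open>Determinant and inverse of matrix-valued maps\<close>

lemma Ck_on_vec_nth: "Ck_on L m W f \<Longrightarrow> Ck_on L m W (\<lambda>x. f x $ i)"
  by (rule Ck_on_bounded_linear[OF bounded_linear_vec_nth])

lemma Ck_on_det:
  fixes F :: "'a::euclidean_space \<Rightarrow> real^'n^'n"
  assumes "Ck_on L m W F"
  shows "Ck_on L m W (\<lambda>x. det (F x))"
  unfolding det_def
  by (intro Ck_on_sum Ck_on_mult Ck_on_prod Ck_on_const Ck_on_vec_nth assms)

lemma matrix_inv_inverse:
  fixes A :: "real^'n^'n"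
  assumes "det A \<noteq> 0"
  shows "A ** matrix_inv A = mat 1" "matrix_inv A ** A = mat 1"
  using someI_ex[OF assms[folded invertible_det_nz, unfolded invertible_def]]
  by (simp_all add: matrix_inv_def)

text \<open>Writes the entries of the inverse as polynomials in the entries of \<open>A\<close>
  divided by \<open>det A\<close>; smoothness of inversion is read off from this form.\<close>

lemma matrix_inv_cramer:
  fixes A :: "real^'n^'n"
  assumes "det A \<noteq> 0"
  shows "matrix_inv A =
    (\<chi> k l. det (\<chi> i j. if j = k then axis l 1 $ i else A $ i $ j) * inverse (det A))"
proof -
  \<comment> \<open>Column \<open>l\<close> of the inverse solves the linear system with right-hand
    side \<open>axis l 1\<close>, to which Cramer's rule applies.\<close>
  have "A *v (matrix_inv A *v axis l 1) = axis l 1" for l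
    using matrix_inv_inverse[OF assms] by (simp add: matrix_vector_mul_assoc)
  then have "matrix_inv A *v axis l 1 =
      (\<chi> k. det (\<chi> i j. if j = k then axis l 1 $ i else A $ i $ j) / det A)" for l
    using cramer[OF assms] by blast
  moreover have "(matrix_inv A *v axis l 1) $ k = matrix_inv A $ k $ l" for k l
    by (simp add: matrix_vector_mul_component inner_axis)
  ultimately show ?thesis
    by (simp add: vec_eq_iff divide_inverse)
qed

lemma Ck_on_matrix_inv:
  fixes F :: "'a::euclidean_space \<Rightarrow> real^'n^'n"
  assumes "Ck_on L m W F" "\<And>x. x \<in> W \<Longrightarrow> det (F x) \<noteq> 0"
  shows "Ck_on L m W (\<lambda>x. matrix_inv (F x))"
proof -
  have "Ck_on L m W (\<lambda>x. if j = k then (axis l 1 :: real^'n) $ i else F x $ i $ j)" for i j k l :: 'n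
    using Ck_on_const Ck_on_vec_nth[OF Ck_on_vec_nth[OF assms(1)]] by (cases "j = k") simp_all
  then have "Ck_on L m W (\<lambda>x. \<chi> k l.
      det (\<chi> i j. if j = k then axis l 1 $ i else F x $ i $ j) * inverse (det (F x)))"
    by (intro Ck_on_vec_lambda Ck_on_mult Ck_on_det Ck_on_inverse assms)
  then show ?thesis
    using assms(2) by (simp add: matrix_inv_cramer cong: Ck_on_cong)
qed

lemma Ck_on_matrix_mult:
  fixes F G :: "'a::euclidean_space \<Rightarrow> real^'n^'n"
  assumes "Ck_on L m W F" "Ck_on L m W G"
  shows "Ck_on L m W (\<lambda>x. F x ** G x)"
  unfolding matrix_matrix_mult_def
  by (intro Ck_on_vec_lambda Ck_on_sum Ck_on_mult Ck_on_vec_nth assms)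

lemma Ck_on_transpose:
  fixes F :: "'a::euclidean_space \<Rightarrow> real^'n^'n"
  assumes "Ck_on L m W F"
  shows "Ck_on L m W (\<lambda>x. transpose (F x))"
  unfolding transpose_def by (intro Ck_on_vec_lambda Ck_on_vec_nth assms)

lemmas Ck_on_intros = Ck_on_const Ck_on_ident Ck_on_add Ck_on_diff Ck_on_matrix_mult
  Ck_on_transpose Ck_on_matrix_inv

lemma open_det_nonzero:
  fixes F :: "'a::euclidean_space \<Rightarrow> real^'n^'n"
  assumes "Ck_on UNIV 0 UNIV F"
  shows "open {x. det (F x) \<noteq> 0}"
  using Ck_on_det[OF assms] by (simp add: open_Collect_neq continuous_on_const)

section \<open>Affine changes of coordinates\<close>

text \<open>The inner map has constant derivative \<open>h\<close>, so differentiating the composite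
  along \<open>v\<close> gives the derivative of \<open>f\<close> along \<open>h v\<close>, composed
  with the same affine map. The induction hypothesis therefore applies again.\<close>

lemma Ck_on_affine:
  assumes "linear h" "Ck_on UNIV m W f"
  shows "Ck_on UNIV m ((\<lambda>x. h x + d) -` W) (\<lambda>x. f (h x + d))"
  using assms(2)
proof (induction m arbitrary: f)
  case 0
  have "continuous_on ((\<lambda>x. h x + d) -` W) (\<lambda>x. h x + d)"
    by (intro continuous_intros linear_continuous_on assms(1)[unfolded linear_conv_bounded_linear])
  then have "continuous_on ((\<lambda>x. h x + d) -` W) (\<lambda>x. f (h x + d))"
    using 0 by (auto intro: continuous_on_compose2)
  then show ?case by simp
next
  case (Suc m)
  then obtain f' where
    f': "\<And>x. x \<in> W \<Longrightarrow> (f has_derivative f' x) (at x within W)"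
    "\<And>v. Ck_on UNIV m W (\<lambda>x. f' x v)" by auto
  let ?V = "(\<lambda>x. h x + d) -` W"
  show ?case
    unfolding Ck_on.simps(2)
  proof (intro exI conjI ballI)
    fix x assume "x \<in> ?V"
    have "((\<lambda>x. h x + d) has_derivative h) (at x within ?V)"
      using assms(1) by (auto intro!: derivative_eq_intros linear_imp_has_derivative)
    moreover have "(f has_derivative f' (h x + d)) (at (h x + d) within (\<lambda>x. h x + d) ` ?V)"
      using f'(1)[of "h x + d"] \<open>x \<in> ?V\<close> by (auto intro: has_derivative_subset)
    ultimately show "((\<lambda>x. f (h x + d)) has_derivative (\<lambda>v. f' (h x + d) (h v))) (at x within ?V)"
      by (rule has_derivative_in_compose)
  qed (rule Suc.IH[OF f'(2)])
qed

text \<open>The chart is pulled back along the inverse \<open>g\<close>. The model space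
  \<open>L\<close> stays the same, and with it the dimension.\<close>

lemma slice_chart_affine_image:
  fixes f g :: "'a::euclidean_space \<Rightarrow> 'a"
  assumes f: "linear f'" "\<And>x. f x = f' x + c" and g: "linear g'" "\<And>x. g x = g' x + d"
    and gf: "\<And>x. g (f x) = x" and fg: "\<And>x. f (g x) = x"
    and chart: "slice_chart M U \<Phi> L"
  shows "slice_chart (f ` M) (f ` U) (\<Phi> \<circ> g) L"
proof -
  have U: "open U" "open (\<Phi> ` U)" "inj_on \<Phi> U" "subspace L" "\<Phi> ` (U \<inter> M) = \<Phi> ` U \<inter> L"
    and sm: "\<And>m. Ck_on UNIV m U \<Phi>" "\<And>m. Ck_on UNIV m (\<Phi> ` U) (inv_into U \<Phi>)"
    using chart by (auto simp: slice_chart_def smooth_on_in_def)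
  \<comment> \<open>As a preimage under \<open>g\<close>, the new domain is open and has the shape
    required by \<open>Ck_on_affine\<close>.\<close>
  have fU: "f ` U = g -` U"
    using gf fg by (auto simp: image_iff) (metis fg)
  have "continuous_on UNIV g"
    unfolding g(2) by (intro continuous_intros linear_continuous_on g(1)[unfolded linear_conv_bounded_linear])
  then have "open (f ` U)"
    unfolding fU using U(1) by (simp add: open_vimage)
  moreover have im: "(\<Phi> \<circ> g) ` f ` S = \<Phi> ` S" for S
    by (auto simp: gf image_image)
  moreover have inj: "inj_on (\<Phi> \<circ> g) (f ` U)"
    using U(3) by (auto simp: inj_on_def gf)
  moreover have "Ck_on UNIV m (f ` U) (\<Phi> \<circ> g)" for m
    using Ck_on_affine[OF g(1) sm(1)] unfolding fU comp_def g(2) .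
  moreover have "Ck_on UNIV m (\<Phi> ` U) (inv_into (f ` U) (\<Phi> \<circ> g))" for m
  proof -
    have "inv_into (f ` U) (\<Phi> \<circ> g) y = f' (inv_into U \<Phi> y) + c" if "y \<in> \<Phi> ` U" for y
    proof (rule inv_into_f_eq[OF inj])
      show "f' (inv_into U \<Phi> y) + c \<in> f ` U"
        using inv_into_into[OF that] by (auto simp: f(2))
      show "(\<Phi> \<circ> g) (f' (inv_into U \<Phi> y) + c) = y"
        using f_inv_into_f[OF that] gf by (simp add: f(2))
    qed
    then have "Ck_on UNIV m (\<Phi> ` U) (inv_into (f ` U) (\<Phi> \<circ> g)) \<longleftrightarrow>
        Ck_on UNIV m (\<Phi> ` U) (\<lambda>y. f' (inv_into U \<Phi> y) + c)"
      by (rule Ck_on_cong)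
    then show ?thesis
      using Ck_on_add[OF Ck_on_bounded_linear[OF f(1)[unfolded linear_conv_bounded_linear] sm(2)] Ck_on_const]
      by simp
  qed
  moreover have "f ` U \<inter> f ` M = f ` (U \<inter> M)"
    by (rule image_Int[symmetric]) (metis gf injI)
  ultimately show ?thesis
    unfolding slice_chart_def smooth_on_in_def using U im by auto
qed

lemma smooth_on_in_ident: "(\<And>x. x \<in> W \<Longrightarrow> f x = x) \<Longrightarrow> smooth_on_in L W f"
  unfolding smooth_on_in_def using Ck_on_cong[of W f "\<lambda>x. x"] by (simp add: Ck_on_ident)

text \<open>Between the charts \<open>\<Phi>\<close> and \<open>\<Phi> \<circ> g\<close> the factors
  \<open>g\<close> and \<open>f\<close> cancel, so the coordinate expressions in both directions are
  identities.\<close>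

lemma diffeomorphism_affine_image:
  fixes f g :: "'a::euclidean_space \<Rightarrow> 'a"
  assumes f: "linear f'" "\<And>x. f x = f' x + c" and g: "linear g'" "\<And>x. g x = g' x + d"
    and gf: "\<And>x. g (f x) = x" and fg: "\<And>x. f (g x) = x"
    and M: "embedded_submanifold M"
  shows "diffeomorphism M (f ` M) f"
proof -
  note chart = slice_chart_affine_image[OF f g gf fg]
  have inj: "inj_on f S" for S by (metis gf inj_onI)
  obtain dm where dm: "\<And>p. p \<in> M \<Longrightarrow> \<exists>U \<Phi> L. p \<in> U \<and> slice_chart M U \<Phi> L \<and> dim L = dm"
    using M unfolding embedded_submanifold_def by blast
  have "embedded_submanifold (f ` M)"
    unfolding embedded_submanifold_def
  proof (intro exI[of _ dm] ballI)
    fix q assume "q \<in> f ` M"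
    then obtain p where p: "p \<in> M" "q = f p" by blast
    with dm obtain U \<Phi> L where "p \<in> U" "slice_chart M U \<Phi> L" "dim L = dm" by blast
    then show "\<exists>U \<Phi> L. q \<in> U \<and> slice_chart (f ` M) U \<Phi> L \<and> dim L = dm"
      using chart p by blast
  qed
  moreover have inv: "inv_into M f (f x) = x" if "x \<in> M" for x
    using inj that by (rule inv_into_f_f)
  moreover have "smooth_map M (f ` M) f"
    unfolding smooth_map_def
  proof (intro conjI ballI)
    fix p assume "p \<in> M"
    with dm obtain U \<Phi> L where U: "p \<in> U" "slice_chart M U \<Phi> L" by blast
    have "inj_on \<Phi> U" using U(2) by (simp add: slice_chart_def)
    then have "smooth_on_in L (\<Phi> ` (U \<inter> M)) (\<Phi> \<circ> g \<circ> f \<circ> inv_into U \<Phi>)"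
      by (intro smooth_on_in_ident) (auto simp: gf inv_into_f_f)
    with U chart[OF U(2)] show "\<exists>U \<Phi> L U' \<Phi>' L'. p \<in> U \<and> slice_chart M U \<Phi> L \<and>
        slice_chart (f ` M) U' \<Phi>' L' \<and> f ` (U \<inter> M) \<subseteq> U' \<and>
        smooth_on_in L (\<Phi> ` (U \<inter> M)) (\<Phi>' \<circ> f \<circ> inv_into U \<Phi>)"
      by blast
  qed simp
  moreover have "smooth_map (f ` M) M (inv_into M f)"
    unfolding smooth_map_def
  proof (intro conjI ballI)
    show "inv_into M f ` f ` M \<subseteq> M" using inv by auto
    fix q assume "q \<in> f ` M"
    then obtain p where p: "p \<in> M" "q = f p" by blast
    with dm obtain U \<Phi> L where U: "p \<in> U" "slice_chart M U \<Phi> L" by blast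
    have \<Phi>: "inj_on (\<Phi> \<circ> g) (f ` U)" using chart[OF U(2)] by (simp add: slice_chart_def)
    have "inv_into (f ` U) (\<Phi> \<circ> g) (\<Phi> x) = f x" if "x \<in> U" for x
      using inv_into_f_f[OF \<Phi>, of "f x"] that by (simp add: gf)
    then have "smooth_on_in L ((\<Phi> \<circ> g) ` (f ` U \<inter> f ` M)) (\<Phi> \<circ> inv_into M f \<circ> inv_into (f ` U) (\<Phi> \<circ> g))"
      unfolding image_Int[OF inj, symmetric] using inv
      by (intro smooth_on_in_ident) (auto simp: gf)
    moreover have "inv_into M f ` (f ` U \<inter> f ` M) \<subseteq> U"
      unfolding image_Int[OF inj, symmetric] using inv by auto
    moreover have "q \<in> f ` U" using p U by simp
    ultimately show "\<exists>U \<Phi> L U' \<Phi>' L'. q \<in> U \<and> slice_chart (f ` M) U \<Phi> L \<and>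
        slice_chart M U' \<Phi>' L' \<and> inv_into M f ` (U \<inter> f ` M) \<subseteq> U' \<and>
        smooth_on_in L (\<Phi> ` (U \<inter> f ` M)) (\<Phi>' \<circ> inv_into M f \<circ> inv_into U \<Phi>)"
      using U(2) chart[OF U(2)] by blast
  qed
  ultimately show ?thesis
    using M inj by (simp add: diffeomorphism_def inj_on_imp_bij_betw)
qed

section \<open>Matrix algebra\<close>

lemma matrix_add_rdistrib: "(B + C) ** A = B ** A + C ** (A :: real^'n^'n)"
  by (simp add: matrix_matrix_mult_def vec_eq_iff sum.distrib algebra_simps)

lemma matrix_diff_ldistrib: "A ** (B - C) = A ** B - A ** (C :: real^'n^'n)"
  by (simp add: matrix_matrix_mult_def vec_eq_iff sum_subtractf algebra_simps)

lemma matrix_diff_rdistrib: "(B - C) ** A = B ** A - C ** (A :: real^'n^'n)"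
  by (simp add: matrix_matrix_mult_def vec_eq_iff sum_subtractf algebra_simps)

lemmas matrix_ring_simps = matrix_add_ldistrib matrix_add_rdistrib matrix_diff_ldistrib
  matrix_diff_rdistrib matrix_mul_assoc[symmetric]

lemma transpose_add: "transpose (A + B) = transpose A + transpose B"
  by (simp add: transpose_def vec_eq_iff)

lemma transpose_diff: "transpose (A - B :: real^'n^'n) = transpose A - transpose B"
  by (simp add: transpose_def vec_eq_iff)

text \<open>Lets a rule for a product of two factors fire inside a longer product that is nested to
  the right.\<close>

lemma matrix_mul_extend: "A ** B = C \<Longrightarrow> A ** (B ** X) = C ** X"
  by (simp add: matrix_mul_assoc)

lemma matrix_inv_commute:
  fixes A C :: "real^'n^'n"
  assumes "det A \<noteq> 0" "C ** A = A ** C"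
  shows "C ** matrix_inv A = matrix_inv A ** C"
proof -
  have "C ** matrix_inv A = matrix_inv A ** (A ** C) ** matrix_inv A"
    using matrix_inv_inverse(2)[OF assms(1)] by (simp add: matrix_mul_assoc)
  also have "\<dots> = matrix_inv A ** C"
    using matrix_inv_inverse(1)[OF assms(1)] unfolding assms(2)[symmetric]
    by (simp add: matrix_mul_assoc[symmetric])
  finally show ?thesis .
qed

lemma transpose_matrix_inv:
  fixes A :: "real^'n^'n"
  assumes "det A \<noteq> 0" "transpose A = A"
  shows "transpose (matrix_inv A) = matrix_inv A"
proof -
  have "A ** transpose (matrix_inv A) = mat 1"
    using arg_cong[OF matrix_inv_inverse(2)[OF assms(1)], of transpose] assms(2)
    by (simp add: matrix_transpose_mul)
  then have "matrix_inv A ** (A ** transpose (matrix_inv A)) = matrix_inv A"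
    by simp
  then show ?thesis
    using matrix_inv_inverse(2)[OF assms(1)] by (simp add: matrix_mul_assoc)
qed

text \<open>Pairing \<open>(mat 1 + transpose B ** B) *v x\<close> with \<open>x\<close> gives the
  sum of the squared norms of \<open>x\<close> and \<open>B *v x\<close>, so the kernel is
  trivial.\<close>

lemma det_one_plus_gram_nonzero:
  fixes B :: "real^'n^'n"
  shows "det (mat 1 + transpose B ** B) \<noteq> 0"
proof -
  have "x = 0" if "(mat 1 + transpose B ** B) *v x = 0" for x
  proof -
    have "0 = x \<bullet> ((mat 1 + transpose B ** B) *v x)" using that by simp
    also have "\<dots> = x \<bullet> x + x \<bullet> (transpose B *v (B *v x))"
      by (simp add: matrix_vector_mult_add_rdistrib matrix_vector_mul_assoc inner_add_right)
    also have "x \<bullet> (transpose B *v (B *v x)) = (B *v x) \<bullet> (B *v x)"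
      by (metis dot_lmul_matrix vector_transpose_matrix)
    finally show "x = 0"
      by (metis add_nonneg_eq_0_iff inner_eq_zero_iff inner_ge_zero)
  qed
  then show ?thesis
    unfolding invertible_det_nz[symmetric] invertible_left_inverse matrix_left_invertible_ker by blast
qed

text \<open>Here \<open>Z\<close> equals \<open>transpose Z ** Z\<close>, whose trace is the sum of
  the squares of all entries of \<open>Z\<close>.\<close>

lemma symmetric_idempotent_trace_eq_0:
  fixes Z :: "real^'n^'n"
  assumes "transpose Z = Z" "Z ** Z = Z" "trace Z = 0"
  shows "Z = 0"
proof -
  have "trace (transpose Z ** Z) = (\<Sum>j\<in>UNIV. \<Sum>i\<in>UNIV. (Z $ i $ j)\<^sup>2)"
    by (simp add: trace_def matrix_matrix_mult_def transpose_def power2_eq_square)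
  then have "(\<Sum>j\<in>UNIV. \<Sum>i\<in>UNIV. (Z $ i $ j)\<^sup>2) = 0"
    using assms by simp
  then show ?thesis
    by (simp add: sum_nonneg_eq_0_iff sum_nonneg vec_eq_iff)
qed

text \<open>Both sides are the trace of \<open>T\<close>, computed in two orthonormal bases.\<close>

lemma dim_range_selfadjoint_idempotent:
  fixes T :: "'a::euclidean_space \<Rightarrow> 'a"
  assumes "linear T" "\<And>x y. T x \<bullet> y = x \<bullet> T y" "\<And>x. T (T x) = T x"
  shows "real (dim (range T)) = (\<Sum>b\<in>Basis. T b \<bullet> b)"
proof -
  have "subspace (range T)"
    using assms(1) by (simp add: linear_subspace_image)
  then obtain E where E: "E \<subseteq> range T" "pairwise orthogonal E" "\<And>x. x \<in> E \<Longrightarrow> norm x = 1"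
    "independent E" "card E = dim (range T)" "span E = range T"
    by (rule orthonormal_basis_subspace) blast
  have fin: "finite E" using E(4) by (rule independent_imp_finite)
  have Te: "T e = e" if "e \<in> E" for e
    using E(1) that assms(3) by blast
  have Tb: "T b \<bullet> b = (\<Sum>e\<in>E. (e \<bullet> b)\<^sup>2)" for b
  proof -
    have "T b = (\<Sum>e\<in>E. (T b \<bullet> e) *\<^sub>R e)"
      using orthonormal_basis_expand[OF E(2,3) _ fin] E(6) by (metis rangeI)
    also have "\<dots> = (\<Sum>e\<in>E. (e \<bullet> b) *\<^sub>R e)"
      using assms(2)[of b] Te by (intro sum.cong) (simp_all add: inner_commute)
    finally have "T b \<bullet> b = (\<Sum>e\<in>E. (e \<bullet> b) *\<^sub>R e) \<bullet> b" by simp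
    then show ?thesis by (simp add: inner_sum_left power2_eq_square)
  qed
  have "(\<Sum>b\<in>Basis. T b \<bullet> b) = (\<Sum>e\<in>E. \<Sum>b\<in>Basis. (e \<bullet> b)\<^sup>2)"
    unfolding Tb by (rule sum.swap)
  also have "\<dots> = (\<Sum>e\<in>E. 1)"
  proof (rule sum.cong)
    fix e assume "e \<in> E"
    then have "e \<bullet> e = 1" using E(3) by (simp add: norm_eq_1)
    then show "(\<Sum>b\<in>Basis. (e \<bullet> b)\<^sup>2) = 1"
      using euclidean_inner[of e e] by (simp add: power2_eq_square)
  qed simp
  finally show ?thesis using E(5) by simp
qed

lemma sum_Basis_matrix:
  fixes h :: "real^'n^'m \<Rightarrow> real"
  shows "(\<Sum>b\<in>Basis. h b) = (\<Sum>i\<in>UNIV. \<Sum>j\<in>UNIV. h (axis i (axis j 1)))"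
proof -
  have "Basis = (\<lambda>(i, j). axis i (axis j 1) :: real^'n^'m) ` UNIV"
    by (auto simp: Basis_vec_def)
  moreover have "inj (\<lambda>(i, j). axis i (axis j 1) :: real^'n^'m)"
    by (auto simp: inj_on_def axis_eq_axis)
  ultimately have "(\<Sum>b\<in>Basis. h b) = (\<Sum>p\<in>UNIV. h (case p of (i, j) \<Rightarrow> axis i (axis j 1)))"
    by (auto intro!: sum.reindex_cong)
  then show ?thesis
    by (simp add: sum.cartesian_product case_prod_unfold)
qed

lemma linear_two_sided_mult:
  fixes A B :: "real^'n^'n"
  shows "linear (\<lambda>X. A ** X ** B)"
  by (rule linearI) (simp_all add: matrix_add_ldistrib matrix_add_rdistrib
      matrix_scalar_ac scalar_matrix_assoc)

text \<open>The map is a self-adjoint idempotent for the Frobenius inner product. Its diagonal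
  coefficient at the matrix unit with indices \<open>i\<close>, \<open>j\<close> is
  \<open>Q $ i $ i * P $ j $ j\<close>, and summing these gives the product of traces.\<close>

lemma dim_range_two_sided_projection:
  fixes P Q :: "real^'n^'n"
  assumes "transpose P = P" "P ** P = P" "transpose Q = Q" "Q ** Q = Q"
  shows "real (dim (range (\<lambda>X. Q ** X ** P))) = trace Q * trace P"
proof -
  have tr: "A \<bullet> B = trace (transpose A ** B)" for A B :: "real^'n^'n"
    unfolding inner_vec_def trace_def matrix_matrix_mult_def transpose_def
    by (simp, subst sum.swap, simp)
  note lin = linear_two_sided_mult[of Q P]
  have adj: "(Q ** X ** P) \<bullet> Y = X \<bullet> (Q ** Y ** P)" for X Y
  proof -
    have "trace (P ** (transpose X ** Q ** Y)) = trace (transpose X ** Q ** Y ** P)"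
      by (rule trace_mul_sym)
    then show ?thesis
      by (simp add: tr matrix_transpose_mul assms matrix_mul_assoc)
  qed
  have idem: "Q ** (Q ** X ** P) ** P = Q ** X ** P" for X
    using assms by (metis matrix_mul_assoc)
  have "(Q ** axis i (axis j 1)) $ a $ b = (if b = j then Q $ a $ i else 0)" for i j a b :: 'n
  proof -
    have "Q $ a $ m * axis i (axis j 1 :: real^'n) $ m $ b =
        (if m = i then if b = j then Q $ a $ i else 0 else 0)" for m
      by (simp add: axis_def)
    then show ?thesis by (simp add: matrix_matrix_mult_def)
  qed
  then have "(Q ** axis i (axis j 1) ** P) \<bullet> axis i (axis j 1) = Q $ i $ i * P $ j $ j" for i j
    unfolding matrix_matrix_mult_def[of _ P] by (simp add: inner_axis if_distrib[of "\<lambda>x. x * _"] cong: if_cong)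
  then show ?thesis
    unfolding dim_range_selfadjoint_idempotent[OF lin adj idem] sum_Basis_matrix
    by (simp add: trace_def sum_product)
qed

section \<open>A slice chart around an orthogonal projection\<close>

locale orthogonal_projection =
  fixes P :: "real^'n^'n"
  assumes transpose_P: "transpose P = P" and P_P: "P ** P = P"
begin

definition Q :: "real^'n^'n" where "Q = mat 1 - P"

definition offdiag :: "(real^'n^'n) set" where "offdiag = range (\<lambda>X. Q ** X ** P)"

text \<open>
  In block form relative to \<open>range P \<oplus> range Q\<close>, with \<open>X = [[a, b], [c, d]]\<close>, \<open>core X\<close> is \<open>[[a, 0], [0, 1]]\<close> and
  \<open>slope X\<close> has the single nonzero block \<open>c a\<^sup>-\<^sup>1\<close>; \<open>graph B\<close> is the orthogonal projection onto the
  graph of \<open>B : range P \<rightarrow> range Q\<close>.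
\<close>

definition core :: "real^'n^'n \<Rightarrow> real^'n^'n" where "core X = P ** X ** P + Q"

definition slope :: "real^'n^'n \<Rightarrow> real^'n^'n"
  where "slope X = Q ** X ** P ** matrix_inv (core X)"

definition graph :: "real^'n^'n \<Rightarrow> real^'n^'n"
  where "graph B = (P + B) ** matrix_inv (mat 1 + transpose B ** B) ** (P + transpose B)"

text \<open>
  \<open>flat X\<close> stores the slope in the lower left block; its other blocks measure the deviation of \<open>X\<close>
  from the projection onto the graph of that slope. For the inverse, the slope \<open>B\<close> and then
  \<open>a\<close>, \<open>b\<close>, \<open>d\<close> (together \<open>unflat_diag\<close>) can be read off, and \<open>c = B a\<close>.
\<close>

definition flat :: "real^'n^'n \<Rightarrow> real^'n^'n"
  where "flat X = (let B = slope X; R = X - graph B in R - Q ** R ** P + B)"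

definition unflat_diag :: "real^'n^'n \<Rightarrow> real^'n^'n"
  where "unflat_diag Z = (let B = Q ** Z ** P in Z - B + (graph B - Q ** graph B ** P))"

definition unflat :: "real^'n^'n \<Rightarrow> real^'n^'n"
  where "unflat Z = unflat_diag Z + Q ** Z ** P ** unflat_diag Z ** P"

definition dom :: "(real^'n^'n) set" where "dom = {X. det (core X) \<noteq> 0}"

text \<open>The upper left block of the preimage is already present in \<open>unflat_diag Z\<close>,
  so this condition says that \<open>unflat Z\<close> lies in \<open>dom\<close>.\<close>

definition cod :: "(real^'n^'n) set" where "cod = {Z. det (core (unflat_diag Z)) \<noteq> 0}"

section \<open>Block calculus relative to \<open>P\<close> and \<open>Q\<close>\<close>

lemma Q_simps: "P ** Q = 0" "Q ** P = 0" "Q ** Q = Q" "transpose Q = Q"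
  by (simp_all add: Q_def matrix_ring_simps P_P transpose_P transpose_diff)

lemmas PQ = P_P transpose_P Q_simps
lemmas PQ_simps = PQ PQ(1,3,4,5)[THEN matrix_mul_extend]

lemma offdiagD:
  assumes "B \<in> offdiag"
  shows "Q ** B = B" "B ** P = B" "P ** B = 0" "B ** Q = 0"
    "transpose B ** Q = transpose B" "P ** transpose B = transpose B"
    "transpose B ** P = 0" "Q ** transpose B = 0"
proof -
  from assms obtain X where X: "B = Q ** X ** P" by (auto simp: offdiag_def)
  then have Xt: "transpose B = P ** transpose X ** Q"
    by (simp add: matrix_transpose_mul PQ matrix_mul_assoc)
  show "Q ** B = B" "B ** P = B" "P ** B = 0" "B ** Q = 0"
    by (simp_all add: X matrix_ring_simps PQ_simps)
  show "transpose B ** Q = transpose B" "P ** transpose B = transpose B"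
    "transpose B ** P = 0" "Q ** transpose B = 0"
    by (simp_all only: Xt matrix_ring_simps PQ_simps times0_left times0_right)
qed

lemma offdiagI: "Q ** X ** P \<in> offdiag"
  by (simp add: offdiag_def)

lemma Q_P_offdiag: "B \<in> offdiag \<Longrightarrow> Q ** B ** P = B"
  using offdiagD by simp

lemma subspace_offdiag: "subspace offdiag"
  unfolding offdiag_def by (intro linear_subspace_image linear_two_sided_mult subspace_UNIV)

lemma dim_offdiag: "real (dim offdiag) = (real CARD('n) - trace P) * trace P"
proof -
  have "trace Q = real CARD('n) - trace P"
    by (simp add: Q_def trace_sub trace_I)
  then show ?thesis
    unfolding offdiag_def using dim_range_two_sided_projection[of P Q] PQ by simp
qed

text \<open>\<open>core X\<close> is block diagonal with the identity as its lower right block; this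
  allows its inverse to be moved past \<open>P\<close> and absorbed by \<open>Q\<close>.\<close>

lemma core_commute: "P ** core X = core X ** P" "Q ** core X = Q" "core X ** Q = Q"
  by (simp_all add: core_def matrix_ring_simps PQ_simps)

lemma slope:
  assumes "X \<in> dom"
  shows "slope X \<in> offdiag" "slope X ** core X = Q ** X ** P"
proof -
  have nz: "det (core X) \<noteq> 0" using assms by (simp add: dom_def)
  have "slope X = Q ** (X ** matrix_inv (core X)) ** P"
    using matrix_inv_commute[OF nz core_commute(1)]
    by (simp add: slope_def matrix_mul_assoc[symmetric])
  then show "slope X \<in> offdiag" using offdiagI by metis
  show "slope X ** core X = Q ** X ** P"
    using matrix_inv_inverse(2)[OF nz] by (simp add: slope_def matrix_mul_assoc[symmetric])
qed

text \<open>Identifies the slope of a reconstructed matrix from the linear equation alone, without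
  computing an inverse.\<close>

lemma slope_unique:
  assumes "X \<in> dom" "B ** core X = Q ** X ** P"
  shows "slope X = B"
proof -
  have nz: "det (core X) \<noteq> 0" using assms by (simp add: dom_def)
  have "slope X = B ** core X ** matrix_inv (core X)"
    by (simp add: slope_def assms(2))
  then show ?thesis
    using matrix_inv_inverse(1)[OF nz] by (simp add: matrix_mul_assoc[symmetric])
qed

text \<open>With \<open>C = P + B\<close>, whose range is the graph of \<open>B\<close>, this is the
  usual formula for the orthogonal projection onto the range of \<open>C\<close>. The last identity
  says that vectors in the range of \<open>graph B\<close> have \<open>Q\<close>-component given by
  \<open>B\<close>.\<close>

lemma graph_projection:
  assumes B: "B \<in> offdiag"
  shows "transpose (graph B) = graph B" "graph B ** graph B = graph B"
    "trace (graph B) = trace P" "Q ** graph B = B ** graph B"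
proof -
  let ?G = "mat 1 + transpose B ** B" and ?C = "P + B"
  have G: "det ?G \<noteq> 0" by (rule det_one_plus_gram_nonzero)
  note Gi = matrix_inv_inverse[OF G]
  note B_simps = offdiagD[OF B] offdiagD[OF B, THEN matrix_mul_extend]
  have tC: "transpose ?C = P + transpose B" by (simp add: transpose_add PQ)
  have gr: "graph B = ?C ** matrix_inv ?G ** transpose ?C" by (simp add: graph_def tC)
  have "transpose ?G = ?G" by (simp add: transpose_add matrix_transpose_mul)
  then have Gt: "transpose (matrix_inv ?G) = matrix_inv ?G"
    by (rule transpose_matrix_inv[OF G])
  show "transpose (graph B) = graph B"
    by (simp add: gr matrix_transpose_mul Gt matrix_mul_assoc)
  \<comment> \<open>The Gram matrix of \<open>?C\<close> vanishes on \<open>range Q\<close>;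
    \<open>?G\<close> agrees with it on \<open>range P\<close> and is the identity on
    \<open>range Q\<close>, hence can be inverted in its place.\<close>
  have CC: "transpose ?C ** ?C = ?G ** P"
    unfolding tC by (simp add: matrix_ring_simps PQ B_simps)
  have "?C ** P = ?C" by (simp add: matrix_ring_simps PQ B_simps)
  have "P ** ?G = ?G ** P"
    by (simp add: matrix_ring_simps PQ B_simps)
  then have GP: "P ** matrix_inv ?G = matrix_inv ?G ** P"
    by (rule matrix_inv_commute[OF G])
  have "graph B ** graph B =
      ?C ** matrix_inv ?G ** (transpose ?C ** ?C) ** matrix_inv ?G ** transpose ?C"
    by (simp only: gr matrix_mul_assoc)
  also have "\<dots> = ?C ** (matrix_inv ?G ** ?G) ** P ** matrix_inv ?G ** transpose ?C"
    by (simp only: CC matrix_mul_assoc)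
  also have "\<dots> = graph B"
    by (simp add: Gi \<open>?C ** P = ?C\<close> gr)
  finally show "graph B ** graph B = graph B" .
  have "trace (graph B) = trace (?C ** (matrix_inv ?G ** transpose ?C))"
    by (simp add: gr matrix_mul_assoc)
  also have "\<dots> = trace (matrix_inv ?G ** (transpose ?C ** ?C))"
    by (subst trace_mul_sym) (simp add: matrix_mul_assoc)
  also have "\<dots> = trace P"
    by (simp add: CC matrix_mul_assoc Gi)
  finally show "trace (graph B) = trace P" .
  \<comment> \<open>\<open>B\<close> maps into \<open>range Q\<close>, where it vanishes, so
    \<open>B ** ?C\<close> reduces to \<open>B\<close>.\<close>
  have "B ** B = B ** P ** B" by (simp only: offdiagD(2)[OF B])
  also have "\<dots> = 0" by (simp only: matrix_mul_assoc[symmetric] offdiagD(3)[OF B] times0_right)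
  finally have "Q ** ?C = B ** ?C"
    by (simp add: matrix_add_ldistrib PQ offdiagD[OF B])
  then show "Q ** graph B = B ** graph B"
    by (simp add: gr matrix_mul_assoc)
qed

section \<open>The flattening and its explicit inverse\<close>

lemma Q_flat_P: "Q ** flat X ** P = slope X" if "X \<in> dom"
  using offdiagD[OF slope(1)[OF that]]
  by (simp add: flat_def Let_def matrix_ring_simps PQ_simps)

lemma unflat_flat:
  assumes X: "X \<in> dom"
  shows "unflat (flat X) = X" "flat X \<in> cod"
proof -
  let ?B = "slope X"
  note B = offdiagD[OF slope(1)[OF X]] offdiagD[OF slope(1)[OF X], THEN matrix_mul_extend]
  \<comment> \<open>Removing the slope and adding back the other three blocks of the graph
    projection restores all of \<open>X\<close> but its lower left block.\<close>
  have W: "unflat_diag (flat X) = X - Q ** X ** P"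
    unfolding unflat_diag_def Let_def Q_flat_P[OF X]
    by (simp add: flat_def Let_def matrix_ring_simps)
  have core_W: "core (X - Q ** X ** P) = core X"
    by (simp add: core_def matrix_ring_simps PQ_simps)
  then show "flat X \<in> cod"
    using X by (simp add: cod_def dom_def W)
  \<comment> \<open>The slope times the upper left block is the missing lower left block, by the
    equation defining the slope.\<close>
  have "?B ** (X - Q ** X ** P) ** P = ?B ** core X"
    by (simp add: core_def matrix_ring_simps PQ_simps B)
  then show "unflat (flat X) = X"
    unfolding unflat_def W Q_flat_P[OF X] slope(2)[OF X] by simp
qed

lemma flat_unflat:
  assumes Z: "Z \<in> cod"
  shows "unflat Z \<in> dom" "flat (unflat Z) = Z"
proof -
  define B where "B = Q ** Z ** P"
  have "B \<in> offdiag" by (simp add: B_def offdiagI)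
  note B = offdiagD[OF this] offdiagD[OF this, THEN matrix_mul_extend]
  define W where "W = unflat_diag Z"
  have W: "W = Z - B + (graph B - Q ** graph B ** P)"
    by (simp add: W_def B_def unflat_diag_def Let_def)
  have X: "unflat Z = W + B ** W ** P"
    by (simp add: unflat_def W_def B_def)
  \<comment> \<open>Both summands of \<open>W\<close> had their lower left block subtracted.\<close>
  have QWP: "Q ** W ** P = 0"
    unfolding W by (simp add: matrix_ring_simps PQ_simps B) (simp add: B_def matrix_ring_simps)
  have core: "core (unflat Z) = core W"
    by (simp add: core_def X matrix_ring_simps PQ_simps B)
  then show dom: "unflat Z \<in> dom"
    using Z by (simp add: cod_def dom_def W_def)
  have QXP: "Q ** unflat Z ** P = B ** W ** P"
    using QWP by (simp add: X matrix_ring_simps PQ_simps B)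
  also have "\<dots> = B ** core (unflat Z)"
    unfolding core by (simp add: core_def matrix_ring_simps PQ_simps B)
  finally have slope: "slope (unflat Z) = B"
    using slope_unique[OF dom] by simp
  have "flat (unflat Z) = unflat Z - graph B - (Q ** unflat Z ** P - Q ** graph B ** P) + B"
    by (simp add: flat_def Let_def slope matrix_diff_ldistrib matrix_diff_rdistrib)
  also have "\<dots> = Z"
    unfolding QXP unfolding X W by simp
  finally show "flat (unflat Z) = Z" .
qed

text \<open>
  No rank argument is needed: near \<open>P\<close>, the trace alone forces a symmetric idempotent to coincide
  with the projection onto the graph of its slope.
\<close>

lemma projection_eq_graph:
  assumes X: "X \<in> dom" "transpose X = X" "X ** X = X" "trace X = trace P"
  shows "X = graph (slope X)"
proof -
  let ?B = "slope X" and ?A = "matrix_inv (core X)"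
  have nz: "det (core X) \<noteq> 0" using X by (simp add: dom_def)
  note A = matrix_inv_inverse[OF nz]
  note B = slope(1)[OF X(1)]
  have QA: "Q ** ?A = Q"
    using core_commute(2)[of X] A(1) by (metis matrix_mul_assoc matrix_mul_rid)
  have "P ** X ** P ** ?A = (core X - Q) ** ?A" by (simp add: core_def)
  also have "\<dots> = P"
    unfolding matrix_diff_rdistrib A QA by (simp add: Q_def)
  finally have "X ** P ** ?A = P + ?B"
    unfolding slope_def Q_def matrix_diff_rdistrib by simp
  \<comment> \<open>\<open>P + ?B\<close> has been written with \<open>X\<close> as its left factor,
    so idempotence of \<open>X\<close> fixes it; hence the range of \<open>graph ?B\<close> lies in
    that of \<open>X\<close>.\<close>
  then have "X ** (P + ?B) = P + ?B"
    using X(3) by (metis matrix_mul_assoc)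
  then have XY: "X ** graph ?B = graph ?B"
    by (simp add: graph_def matrix_mul_assoc)
  note Y = graph_projection[OF B]
  have YX: "graph ?B ** X = graph ?B"
    using arg_cong[OF XY, of transpose] X(2) Y(1) by (simp add: matrix_transpose_mul)
  \<comment> \<open>A difference of nested orthogonal projections is again one, and the equal traces
    give it trace 0.\<close>
  have "X - graph ?B = 0"
    by (rule symmetric_idempotent_trace_eq_0)
      (simp_all add: transpose_diff X Y matrix_diff_ldistrib matrix_diff_rdistrib XY YX trace_sub)
  then show ?thesis by simp
qed

lemma flat_projections:
  assumes k: "trace P = real k"
  shows "flat ` (dom \<inter> projections_of_trace k) = cod \<inter> offdiag"
proof (intro equalityI subsetI)
  fix Z assume "Z \<in> flat ` (dom \<inter> projections_of_trace k)"
  then obtain X where X: "Z = flat X" "X \<in> dom" "transpose X = X" "X ** X = X" "trace X = trace P"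
    using k by (auto simp: projections_of_trace_def)
  \<comment> \<open>The residual \<open>X - graph (slope X)\<close> vanishes.\<close>
  have "flat X = slope X"
    using projection_eq_graph[OF X(2-)] by (simp add: flat_def Let_def)
  then show "Z \<in> cod \<inter> offdiag"
    using X(1) unflat_flat(2)[OF X(2)] slope(1)[OF X(2)] by simp
next
  fix Z assume Z: "Z \<in> cod \<inter> offdiag"
  then have QZP: "Q ** Z ** P = Z" by (simp add: Q_P_offdiag)
  note G = graph_projection[of Z]
  have "unflat_diag Z = graph Z - Q ** graph Z ** P"
    by (simp add: unflat_diag_def QZP)
  moreover have "unflat Z = unflat_diag Z + Z ** unflat_diag Z ** P"
    by (simp only: unflat_def QZP)
  moreover have "Z ** Q = 0" using Z offdiagD by blast
  \<comment> \<open>\<open>Z ** Q = 0\<close> removes the correction term, and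
    \<open>Z ** graph Z = Q ** graph Z\<close> supplies exactly the lower left block that was taken
    out.\<close>
  ultimately have "unflat Z = graph Z"
    using Z G(4) by (simp add: matrix_diff_ldistrib matrix_diff_rdistrib matrix_mul_assoc)
  then have "unflat Z \<in> projections_of_trace k"
    using G Z k by (simp add: projections_of_trace_def)
  then show "Z \<in> flat ` (dom \<inter> projections_of_trace k)"
    using flat_unflat Z by (metis IntE IntI image_eqI)
qed

section \<open>Smoothness of the flattening and its inverse\<close>

lemma Ck_on_graph:
  "Ck_on L m W F \<Longrightarrow> Ck_on L m W (\<lambda>x. graph (F x))"
  unfolding graph_def by (intro Ck_on_intros det_one_plus_gram_nonzero)

lemma Ck_on_slope: "Ck_on L m dom slope"
proof -
  have "Ck_on L m dom (\<lambda>X. Q ** X ** P ** matrix_inv (P ** X ** P + Q))"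
    by (intro Ck_on_intros) (simp add: dom_def core_def)
  then show ?thesis by (simp add: slope_def[abs_def] core_def)
qed

lemma Ck_on_flat: "Ck_on L m dom flat"
proof -
  have "Ck_on L m dom (\<lambda>X. X - graph (slope X) - Q ** (X - graph (slope X)) ** P + slope X)"
    by (intro Ck_on_intros Ck_on_graph Ck_on_slope)
  then show ?thesis by (simp add: flat_def[abs_def] Let_def)
qed

text \<open>The only matrix inverted is \<open>mat 1 + transpose B ** B\<close>, which is never
  singular, so any set \<open>W\<close> is allowed.\<close>

lemma Ck_on_unflat_diag: "Ck_on L m W unflat_diag"
  unfolding unflat_diag_def[abs_def] Let_def by (intro Ck_on_intros Ck_on_graph)

lemma Ck_on_unflat: "Ck_on L m W unflat"
  unfolding unflat_def[abs_def] by (intro Ck_on_intros Ck_on_unflat_diag)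

lemma slice_chart_flat:
  assumes k: "trace P = real k"
  shows "slice_chart (projections_of_trace k) dom flat offdiag"
proof -
  have inj: "inj_on flat dom" using unflat_flat(1) by (rule inj_on_inverseI)
  have im: "flat ` dom = cod"
    using unflat_flat(2) flat_unflat by (force simp: image_iff)
  have inv: "inv_into dom flat Z = unflat Z" if "Z \<in> cod" for Z
    by (rule inv_into_f_eq[OF inj flat_unflat[OF that]])
  have "Ck_on UNIV 0 UNIV core" "Ck_on UNIV 0 UNIV (\<lambda>Z. core (unflat_diag Z))"
    unfolding core_def[abs_def] by (intro Ck_on_intros Ck_on_unflat_diag)+
  then have "open dom" "open cod"
    using open_det_nonzero unfolding dom_def cod_def by blast+
  moreover have "Ck_on UNIV m cod (inv_into dom flat)" for m
    using Ck_on_unflat inv Ck_on_cong by metis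
  ultimately show ?thesis
    unfolding slice_chart_def smooth_on_in_def im
    using inj subspace_offdiag flat_projections[OF k] Ck_on_flat by simp
qed

lemma P_in_dom: "P \<in> dom"
proof -
  have "core P = mat 1" by (simp add: core_def PQ) (simp add: Q_def)
  then show ?thesis by (simp add: dom_def)
qed

end

section \<open>The submanifold of projections and its image under \<open>phi2\<close>\<close>

lemma embedded_submanifold_projections:
  "embedded_submanifold (projections_of_trace k :: (real^'n^'n) set)"
proof -
  \<comment> \<open>One dimension must serve all points, so it is expressed through \<open>k\<close>
    alone; subtracting in the reals avoids truncation.\<close>
  have "\<exists>U \<Phi> L. P \<in> U \<and> slice_chart (projections_of_trace k) U \<Phi> L \<and>
      dim L = nat \<lfloor>(real CARD('n) - real k) * real k\<rfloor>"
    if "P \<in> projections_of_trace k" for P :: "real^'n^'n"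
  proof -
    interpret orthogonal_projection P
      using that by unfold_locales (auto simp: projections_of_trace_def)
    have k: "trace P = real k" using that by (simp add: projections_of_trace_def)
    have "real (dim offdiag) = (real CARD('n) - real k) * real k"
      using dim_offdiag k by simp
    then have "dim offdiag = nat \<lfloor>(real CARD('n) - real k) * real k\<rfloor>"
      by (metis floor_of_nat nat_int)
    then show ?thesis
      using P_in_dom slice_chart_flat[OF k] by blast
  qed
  then show ?thesis
    unfolding embedded_submanifold_def by blast
qed

text \<open>For symmetric \<open>R\<close> orthogonality means \<open>R ** R = mat 1\<close>, and
  with \<open>R = 2 *\<^sub>R X - mat 1\<close> this is equivalent to \<open>X ** X = X\<close>. The
  trace of the identity produces the shift by \<open>CARD('n)\<close>.\<close>

lemma phi2_image_projections:
  "phi2 ` (projections_of_trace k :: (real^'n^'n) set) =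
    symmetric_orthogonal_of_trace (2 * real k - real CARD('n))"
proof (intro equalityI subsetI)
  have trace_scale: "trace (c *\<^sub>R A) = c * trace A" for c and A :: "real^'n^'n"
    by (simp add: trace_def sum_distrib_left)
  {
    fix R :: "real^'n^'n" assume "R \<in> phi2 ` projections_of_trace k"
    then obtain X where X: "transpose X = X" "X ** X = X" "trace X = real k" "R = phi2 X"
      by (auto simp: projections_of_trace_def)
    have "R ** R = 2 *\<^sub>R (2 *\<^sub>R (X ** X) - X) - (2 *\<^sub>R X - mat 1)"
      unfolding X(4) phi2_def matrix_diff_ldistrib matrix_diff_rdistrib matrix_scalar_ac
        scalar_matrix_assoc[symmetric] by (simp only: matrix_mul_lid matrix_mul_rid)
    then have "R ** R = mat 1" by (simp add: X(2) scaleR_2)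
    then show "R \<in> symmetric_orthogonal_of_trace (2 * real k - real CARD('n))"
      using X by (simp add: symmetric_orthogonal_of_trace_def orthogonal_matrix phi2_def
          transpose_diff transpose_scalar trace_sub trace_I trace_scale)
  next
    fix R :: "real^'n^'n"
    assume "R \<in> symmetric_orthogonal_of_trace (2 * real k - real CARD('n))"
    then have R: "R ** R = mat 1" "transpose R = R" "trace R = 2 * real k - real CARD('n)"
      by (auto simp: symmetric_orthogonal_of_trace_def orthogonal_matrix)
    let ?X = "(1/2) *\<^sub>R (mat 1 + R)"
    have "?X ** ?X = (1/4) *\<^sub>R (2 *\<^sub>R (mat 1 + R))"
      by (simp add: matrix_scalar_ac scalar_matrix_assoc[symmetric] matrix_add_ldistrib
          matrix_add_rdistrib R scaleR_2 add_ac)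
    then have "?X \<in> projections_of_trace k"
      by (simp add: projections_of_trace_def transpose_scalar transpose_add R trace_scale
          trace_add trace_I)
    moreover have "R = phi2 ?X" by (simp add: phi2_def)
    ultimately show "R \<in> phi2 ` projections_of_trace k" by blast
  }
qed

theorem proposition2p3:
  fixes k :: nat
  assumes "k \<in> {1..CARD('n::finite)}"
  shows "diffeomorphism
           (projections_of_trace k :: (real^'n^'n) set)
           (symmetric_orthogonal_of_trace (2 * real k - real CARD('n)))
           phi2
       \<and> (\<forall>Q \<in> (symmetric_orthogonal_of_trace (2 * real k - real CARD('n)) :: (real^'n^'n) set).
            inv_into (projections_of_trace k) phi2 Q = (1/2) *\<^sub>R (mat 1 + Q))"
proof -
  let ?g = "\<lambda>R. (1/2) *\<^sub>R (mat 1 + R) :: real^'n^'n"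
  have gf: "?g (phi2 X) = X" and fg: "phi2 (?g X) = X" for X
    by (simp_all add: phi2_def)
  \<comment> \<open>The target enters as an image, so its submanifold structure and surjectivity
    come with the transport of charts.\<close>
  have "diffeomorphism (projections_of_trace k :: (real^'n^'n) set) (phi2 ` projections_of_trace k) phi2"
    by (rule diffeomorphism_affine_image[where f' = "\<lambda>X. 2 *\<^sub>R X" and c = "- mat 1"
          and g' = "\<lambda>X. (1/2) *\<^sub>R X" and d = "(1/2) *\<^sub>R mat 1" and g = ?g,
          OF _ _ _ _ gf fg embedded_submanifold_projections])
      (simp_all add: phi2_def scaleR_right_distrib linear_scaleR)
  moreover have "inv_into (projections_of_trace k) phi2 (phi2 X) = ?g (phi2 X)"
    if "X \<in> projections_of_trace k" for X
    using that inv_into_f_f[of phi2 "projections_of_trace k" X] gf by (metis inj_onI)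
  ultimately show ?thesis
    unfolding phi2_image_projections[symmetric] by blast
qed

end
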